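(* Let $\Phi(x):=(\nu_z.\langle v\rangle x\wedge\langle h\rangle z)\vee[v]\bot$ (actions $\{h,v\}$) and let $\Phi'$ be the monomodal formula obtained from $\mathrm{tr}(\Phi)$ by substituting $\Diamond\Box\bot$ for $p$ (and correspondingly $\Box\Diamond\top$ for $\neg p$). Then $\Phi'$ has closure ordinal $\omega_1$.
   Context: Monomodal formulas use a single pair of modalities $\Diamond,\Box$. The translation $\mathrm{tr}$ from $\{h,v\}$-formulas to monomodal formulas (with a fresh variable $p$) uses $\psi_h(p,q)=p\wedge\Diamond(p\wedge q)$, $\psi_v(p,q)=p\wedge\Diamond(\neg p\wedge\Diamond(\neg p\wedge\Diamond(p\wedge q)))$, and their duals $\psi_b^{op}$ (formulas equivalent to $\neg\psi_b[\neg q/q]$, e.g. $\psi_h^{op}=\neg p\vee\Box(\neg p\vee q)$, $\psi_v^{op}=\neg p\vee\Box(p\vee\Box(p\vee\Box(\neg p\vee q)))$), and is defined by: $\mathrm{tr}(y)=p\wedge y$, $\mathrm{tr}(\neg y)=p\wedge\neg y$, $\mathrm{tr}(\bot)=\bot$, $\mathrm{tr}(\top)=p$, $\mathrm{tr}(\psi_0\,@\,\psi_1)=\mathrm{tr}(\psi_0)\,@\,\mathrm{tr}(\psi_1)$ ($@\in\{\wedge,\vee\}$), $\mathrm{tr}(\langle b\rangle\psi)=\psi_b[\mathrm{tr}(\psi)/q]$, $\mathrm{tr}([b]\psi)=p\wedge\psi_b^{op}[\mathrm{tr}(\psi)/q]$, $\mathrm{tr}(\mu_z.\psi)=\mu_z.\mathrm{tr}(\psi)$,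 $\mathrm{tr}(\nu_z.\psi)=\nu_z.\mathrm{tr}(\psi)$. Closure ordinal: for a formula $\phi(x)$ and model $\mathcal{M}$, with $\phi_{\mathcal{M}}(S)=[\![\phi]\!]_{\mathcal{M}[x\mapsto S]}$ and approximants $\phi^0_{\mathcal{M}}(\emptyset)=\emptyset$, $\phi^{\alpha+1}_{\mathcal{M}}(\emptyset)=\phi_{\mathcal{M}}(\phi^\alpha_{\mathcal{M}}(\emptyset))$, unions at limits, $\alpha$ is the closure ordinal of $\phi$ if in every model $\phi^\alpha_{\mathcal{M}}(\emptyset)$ is a fixed point and in some model $\alpha$ is the least $\gamma$ with $\phi_{\mathcal{M}}^\gamma(\emptyset)=\phi_{\mathcal{M}}^{\gamma+1}(\emptyset)$. *)

theory Defs
  imports Main "HOL-Library.Countable_Set_Type"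
begin

section \<open>Formulas and models of the modal mu-calculus\<close>

text \<open>
  Formulas are in negation normal form; \<open>'m\<close> is the type of actions. Propositional letters and
  fixed-point variables share one countable supply of names. The datatype does not enforce that a
  variable bound by \<open>Mu\<close> or \<open>Nu\<close> has no negated occurrence in its scope.
\<close>

datatype 'm fm =
    Var nat
  | NVar nat
  | Bot
  | Top
  | And "'m fm" "'m fm"
  | Or "'m fm" "'m fm"
  | Dia 'm "'m fm"
  | Box 'm "'m fm"
  | Mu nat "'m fm"
  | Nu nat "'m fm"

record ('m, 'w) model =
  rel :: "'m \<Rightarrow> ('w \<times> 'w) set"
  val :: "nat \<Rightarrow> 'w set"

definition upd :: "('m, 'w) model \<Rightarrow> nat \<Rightarrow> 'w set \<Rightarrow> ('m, 'w) model" where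
  "upd M x S = M\<lparr>val := (val M)(x := S)\<rparr>"

primrec sem :: "'m fm \<Rightarrow> ('m, 'w) model \<Rightarrow> 'w set" where
  "sem (Var y) M = val M y"
| "sem (NVar y) M = - val M y"
| "sem Bot M = {}"
| "sem Top M = UNIV"
| "sem (And \<phi> \<psi>) M = sem \<phi> M \<inter> sem \<psi> M"
| "sem (Or \<phi> \<psi>) M = sem \<phi> M \<union> sem \<psi> M"
| "sem (Dia a \<phi>) M = {w. \<exists>u. (w, u) \<in> rel M a \<and> u \<in> sem \<phi> M}"
| "sem (Box a \<phi>) M = {w. \<forall>u. (w, u) \<in> rel M a \<longrightarrow> u \<in> sem \<phi> M}"
| "sem (Mu z \<phi>) M = lfp (\<lambda>S. sem \<phi> (upd M z S))"
| "sem (Nu z \<phi>) M = gfp (\<lambda>S. sem \<phi> (upd M z S))"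

definition fm_op :: "'m fm \<Rightarrow> nat \<Rightarrow> ('m, 'w) model \<Rightarrow> 'w set \<Rightarrow> 'w set" where
  "fm_op \<phi> x M S = sem \<phi> (upd M x S)"

section \<open>From two actions to one\<close>

datatype act = H | V

type_synonym hv_fm = "act fm"

text \<open>Monomodal formulas are those over the one-element type of actions.\<close>

type_synonym mono_fm = "unit fm"

abbreviation dia :: "mono_fm \<Rightarrow> mono_fm" where "dia \<equiv> Dia ()"
abbreviation box :: "mono_fm \<Rightarrow> mono_fm" where "box \<equiv> Box ()"

text \<open>
  The argument \<open>q\<close> is the formula plugged in for the placeholder variable. There are no
  binders around it, so function application is substitution.
\<close>

fun psi :: "act \<Rightarrow> nat \<Rightarrow> mono_fm \<Rightarrow> mono_fm" where
  "psi H p q = And (Var p) (dia (And (Var p) q))"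
| "psi V p q =
     And (Var p) (dia (And (NVar p) (dia (And (NVar p) (dia (And (Var p) q))))))"

fun psi_op :: "act \<Rightarrow> nat \<Rightarrow> mono_fm \<Rightarrow> mono_fm" where
  "psi_op H p q = Or (NVar p) (box (Or (NVar p) q))"
| "psi_op V p q =
     Or (NVar p) (box (Or (Var p) (box (Or (Var p) (box (Or (NVar p) q))))))"

primrec tr :: "nat \<Rightarrow> hv_fm \<Rightarrow> mono_fm" where
  "tr p (Var y) = And (Var p) (Var y)"
| "tr p (NVar y) = And (Var p) (NVar y)"
| "tr p Bot = Bot"
| "tr p Top = Var p"
| "tr p (And \<phi> \<psi>) = And (tr p \<phi>) (tr p \<psi>)"
| "tr p (Or \<phi> \<psi>) = Or (tr p \<phi>) (tr p \<psi>)"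
| "tr p (Dia b \<phi>) = psi b p (tr p \<phi>)"
| "tr p (Box b \<phi>) = And (Var p) (psi_op b p (tr p \<phi>))"
| "tr p (Mu z \<phi>) = Mu z (tr p \<phi>)"
| "tr p (Nu z \<phi>) = Nu z (tr p \<phi>)"

text \<open>
  \<open>lit_subst p \<chi> \<chi>' \<phi>\<close> replaces the free occurrences of the literal \<open>p\<close> by \<open>\<chi>\<close> and of the literal
  \<open>\<not> p\<close> by \<open>\<chi>'\<close>. Bound variables are not renamed: it is meant for closed \<open>\<chi>\<close> and \<open>\<chi>'\<close>.
\<close>

primrec lit_subst :: "nat \<Rightarrow> 'm fm \<Rightarrow> 'm fm \<Rightarrow> 'm fm \<Rightarrow> 'm fm" where
  "lit_subst p \<chi> \<chi>' (Var y) = (if y = p then \<chi> else Var y)"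
| "lit_subst p \<chi> \<chi>' (NVar y) = (if y = p then \<chi>' else NVar y)"
| "lit_subst p \<chi> \<chi>' Bot = Bot"
| "lit_subst p \<chi> \<chi>' Top = Top"
| "lit_subst p \<chi> \<chi>' (And \<phi> \<psi>) = And (lit_subst p \<chi> \<chi>' \<phi>) (lit_subst p \<chi> \<chi>' \<psi>)"
| "lit_subst p \<chi> \<chi>' (Or \<phi> \<psi>) = Or (lit_subst p \<chi> \<chi>' \<phi>) (lit_subst p \<chi> \<chi>' \<psi>)"
| "lit_subst p \<chi> \<chi>' (Dia a \<phi>) = Dia a (lit_subst p \<chi> \<chi>' \<phi>)"
| "lit_subst p \<chi> \<chi>' (Box a \<phi>) = Box a (lit_subst p \<chi> \<chi>' \<phi>)"
| "lit_subst p \<chi> \<chi>' (Mu z \<phi>) = Mu z (if z = p then \<phi> else lit_subst p \<chi> \<chi>' \<phi>)"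
| "lit_subst p \<chi> \<chi>' (Nu z \<phi>) = Nu z (if z = p then \<phi> else lit_subst p \<chi> \<chi>' \<phi>)"

definition Phi :: "nat \<Rightarrow> nat \<Rightarrow> hv_fm" where
  "Phi x z = Or (Nu z (And (Dia V (Var x)) (Dia H (Var z)))) (Box V Bot)"

definition Phi' :: "nat \<Rightarrow> nat \<Rightarrow> nat \<Rightarrow> mono_fm" where
  "Phi' x z p = lit_subst p (dia (box Bot)) (box (dia Top)) (tr p (Phi x z))"

section \<open>Ordinals\<close>

text \<open>
  HOL has no type of all ordinals. Elements of a type of class \<open>wellorder\<close> serve as ordinals:
  \<open>\<alpha>\<close> stands for the order type of \<open>{..<\<alpha>}\<close>. The concrete type below consists of
  the ordinals smaller than \<open>\<omega>\<^sub>2\<close>.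
\<close>

abbreviation omega2_rel :: "nat set set rel" where
  "omega2_rel \<equiv> cardSuc (cardSuc natLeq)"

lemma Card_order_omega2_rel: "Card_order omega2_rel"
  by (simp add: cardSuc_Card_order natLeq_Card_order)

lemma Well_order_omega2_rel: "Well_order omega2_rel"
  using Card_order_omega2_rel by (simp add: card_order_on_def)

typedef ordinal = "Field omega2_rel"
  using Field_cardSuc_not_empty[OF cardSuc_Card_order[OF natLeq_Card_order]] by blast

instantiation ordinal :: wellorder
begin

definition less_eq_ordinal :: "ordinal \<Rightarrow> ordinal \<Rightarrow> bool" where
  "\<alpha> \<le> \<beta> \<longleftrightarrow> (Rep_ordinal \<alpha>, Rep_ordinal \<beta>) \<in> omega2_rel"

definition less_ordinal :: "ordinal \<Rightarrow> ordinal \<Rightarrow> bool" where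
  "(\<alpha>::ordinal) < \<beta> \<longleftrightarrow> \<alpha> \<le> \<beta> \<and> \<alpha> \<noteq> \<beta>"

instance
proof
  note W = Well_order_omega2_rel[unfolded order_on_defs]
  fix \<alpha> \<beta> \<gamma> :: ordinal and P :: "ordinal \<Rightarrow> bool"
  show refl: "\<alpha> \<le> \<alpha>"
    using W Rep_ordinal[of \<alpha>] unfolding less_eq_ordinal_def refl_on_def by blast
  show antisym: "\<alpha> = \<beta>" if "\<alpha> \<le> \<beta>" "\<beta> \<le> \<alpha>" for \<alpha> \<beta> :: ordinal
    using W that unfolding less_eq_ordinal_def antisym_def by (metis Rep_ordinal_inject)
  show "\<alpha> < \<beta> \<longleftrightarrow> \<alpha> \<le> \<beta> \<and> \<not> \<beta> \<le> \<alpha>"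
    using antisym W Rep_ordinal[of \<alpha>]
    unfolding less_ordinal_def less_eq_ordinal_def refl_on_def by blast
  show "\<alpha> \<le> \<gamma>" if "\<alpha> \<le> \<beta>" "\<beta> \<le> \<gamma>"
    using W that unfolding less_eq_ordinal_def trans_def by blast
  show "\<alpha> \<le> \<beta> \<or> \<beta> \<le> \<alpha>"
  proof (cases "\<alpha> = \<beta>")
    case True
    then show ?thesis
      using W Rep_ordinal[of \<alpha>] unfolding less_eq_ordinal_def refl_on_def by blast
  next
    case False
    then show ?thesis
      using W Rep_ordinal[of \<alpha>] Rep_ordinal[of \<beta>] Rep_ordinal_inject[of \<alpha> \<beta>]
      unfolding less_eq_ordinal_def total_on_def by blast
  qed
  show "P \<alpha>" if step: "\<And>\<alpha>. (\<And>\<beta>. \<beta> < \<alpha> \<Longrightarrow> P \<beta>) \<Longrightarrow> P \<alpha>"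
  proof -
    have "wf (inv_image (omega2_rel - Id) Rep_ordinal)"
      using W by (intro wf_inv_image) blast
    then show ?thesis
    proof (induction \<alpha> rule: wf_induct_rule)
      case (less \<alpha>)
      show ?case
        by (rule step, rule less)
          (auto simp: less_ordinal_def less_eq_ordinal_def in_inv_image Rep_ordinal_inject)
    qed
  qed
qed

end

definition omega1 :: ordinal where
  "omega1 = (LEAST \<alpha>. uncountable {..<\<alpha>})"

lemma ex_uncountable_ordinal: "\<exists>\<alpha>::ordinal. uncountable {..<\<alpha>}"
proof -
  include cardinal_syntax
  let ?r1 = "cardSuc natLeq" and ?r = omega2_rel
  have c1: "Card_order ?r1"
    by (simp add: cardSuc_Card_order natLeq_Card_order)
  then have w1: "Well_order ?r1"
    by (simp add: card_order_on_def)
  obtain a where a: "a \<in> Field ?r" "?r1 =o Restr ?r (underS ?r a)"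
    using ordLess_iff_ordIso_Restr[OF Well_order_omega2_rel w1] cardSuc_greater[OF c1] by blast
  have "|Field ?r1| =o |Field (Restr ?r (underS ?r a))|"
    using a(2) by (rule card_of_cong)
  moreover have "|Field (Restr ?r (underS ?r a))| \<le>o |underS ?r a|"
    by (rule card_of_mono1) (auto simp: Field_def)
  ultimately have le: "|Field ?r1| \<le>o |underS ?r a|"
    using ordIso_ordLeq_trans by blast
  define \<alpha> where "\<alpha> = Abs_ordinal a"
  have rep: "Rep_ordinal \<alpha> = a"
    using a(1) by (simp add: \<alpha>_def Abs_ordinal_inverse)
  have "underS ?r a \<subseteq> Rep_ordinal ` {..<\<alpha>}"
  proof
    fix b
    assume b: "b \<in> underS ?r a"
    then have "b \<in> Field ?r"
      by (auto simp: underS_def Field_def)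
    then have "Rep_ordinal (Abs_ordinal b) = b"
      by (rule Abs_ordinal_inverse)
    moreover from this have "Abs_ordinal b < \<alpha>"
      using b rep by (auto simp: less_ordinal_def less_eq_ordinal_def underS_def)
    ultimately show "b \<in> Rep_ordinal ` {..<\<alpha>}"
      by (metis imageI lessThan_iff)
  qed
  moreover have "uncountable (underS ?r a)"
  proof
    assume "countable (underS ?r a)"
    then have "|underS ?r a| \<le>o natLeq"
      by (simp add: countable_card_le_natLeq)
    then have "|Field ?r1| \<le>o natLeq"
      using le ordLeq_transitive by blast
    then have "?r1 \<le>o natLeq"
      using card_of_Field_ordIso[OF c1] ordIso_symmetric ordIso_ordLeq_trans by blast
    then show False
      using cardSuc_greater[OF natLeq_Card_order] not_ordLess_ordLeq by blast
  qed
  ultimately show ?thesis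
    by (meson countable_image countable_subset)
qed

lemma uncountable_omega1: "uncountable {..<omega1}"
  unfolding omega1_def by (rule LeastI_ex) (rule ex_uncountable_ordinal)

lemma countable_below_omega1: "\<alpha> < omega1 \<Longrightarrow> countable {..<\<alpha>}"
  unfolding omega1_def using not_less_Least by blast

section \<open>Approximants and closure ordinals\<close>

definition is_pred :: "'o::wellorder \<Rightarrow> 'o \<Rightarrow> bool" where
  "is_pred \<beta> \<alpha> \<longleftrightarrow> \<beta> < \<alpha> \<and> (\<forall>\<gamma><\<alpha>. \<gamma> \<le> \<beta>)"

lemma the_pred: "is_pred \<beta> \<alpha> \<Longrightarrow> (THE \<beta>. is_pred \<beta> \<alpha>) = \<beta>"
  by (rule the_equality) (auto simp: is_pred_def intro: antisym)

function approx :: "('w set \<Rightarrow> 'w set) \<Rightarrow> 'o::wellorder \<Rightarrow> 'w set" where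
  "approx f \<alpha> =
    (if \<forall>\<beta>. \<alpha> \<le> \<beta> then {}
     else if \<exists>\<beta>. is_pred \<beta> \<alpha> then f (approx f (THE \<beta>. is_pred \<beta> \<alpha>))
     else (\<Union>\<beta>\<in>{..<\<alpha>}. approx f \<beta>))"
  by pat_completeness auto
termination
  by (relation "inv_image {(\<beta>, \<alpha>). \<beta> < \<alpha>} snd")
    (auto simp: wf the_pred, simp add: is_pred_def)

declare approx.simps [simp del]

lemma approx_zero: "(\<And>\<beta>. \<alpha> \<le> \<beta>) \<Longrightarrow> approx f \<alpha> = {}"
  by (simp add: approx.simps)

lemma approx_succ: "is_pred \<beta> \<alpha> \<Longrightarrow> approx f \<alpha> = f (approx f \<beta>)"
  by (subst approx.simps) (auto simp: the_pred, auto simp: is_pred_def leD)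

lemma approx_limit:
  "\<gamma> < \<alpha> \<Longrightarrow> \<nexists>\<beta>. is_pred \<beta> \<alpha> \<Longrightarrow> approx f \<alpha> = (\<Union>\<beta>\<in>{..<\<alpha>}. approx f \<beta>)"
  by (subst approx.simps) (auto simp: leD)

text \<open>
  A quantification over all models would have to range over all types of worlds, which HOL does not
  allow inside a formula. The first type argument is the type of worlds of the models in ``every
  model'', to be left a type variable in theorems; the second one is the type of worlds of the
  witness for ``some model''. The approximant at \<open>\<gamma> + 1\<close> is \<open>f (approx f \<gamma>)\<close>.
\<close>

definition closure_ordinal ::
  "'u itself \<Rightarrow> 'e itself \<Rightarrow> 'm fm \<Rightarrow> nat \<Rightarrow> 'o::wellorder \<Rightarrow> bool" where
  "closure_ordinal _ _ \<phi> x \<alpha> \<longleftrightarrow>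
    (\<forall>M :: ('m, 'u) model.
       fm_op \<phi> x M (approx (fm_op \<phi> x M) \<alpha>) = approx (fm_op \<phi> x M) \<alpha>) \<and>
    (\<exists>M :: ('m, 'e) model.
       approx (fm_op \<phi> x M) \<alpha> = fm_op \<phi> x M (approx (fm_op \<phi> x M) \<alpha>) \<and>
       (\<forall>\<gamma><\<alpha>. approx (fm_op \<phi> x M) \<gamma> \<noteq> fm_op \<phi> x M (approx (fm_op \<phi> x M) \<gamma>)))"

end

theory Submission
  imports Defs
begin

text \<open>
  Up to the encoding of \<open>h\<close>- and \<open>v\<close>-steps by paths of the single relation, a world lies in
  \<open>\<Phi>'(S)\<close> iff it has no \<open>v\<close>-step or starts an infinite \<open>h\<close>-path each of whose worlds has a
  \<open>v\<close>-step into \<open>S\<close>. Such a path has only countably many witnesses in \<open>S\<close>; as a countable set of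
  countable ordinals is bounded below \<open>\<omega>\<^sub>1\<close>, the iteration stops at \<open>\<omega>\<^sub>1\<close>. Conversely, give each
  \<open>\<alpha> < \<omega>\<^sub>1\<close> an infinite \<open>h\<close>-path whose \<open>v\<close>-steps enumerate the start worlds of all \<open>\<beta> < \<alpha>\<close>. Then
  the start world of \<open>\<alpha>\<close> enters the iteration exactly at stage \<open>\<alpha> + 1\<close>.
\<close>

section \<open>Approximants of monotone operators\<close>

text \<open>Monotonicity merges the zero, successor and limit clauses into one equation: at a
  successor, the last term of the union contains all the others.\<close>

lemma approx_eq_UN:
  fixes \<alpha> :: "'o::wellorder"
  assumes "mono f"
  shows "approx f \<alpha> = (\<Union>\<beta>\<in>{..<\<alpha>}. f (approx f \<beta>))"
proof (induction \<alpha> rule: less_induct)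
  case (less \<alpha>)
  consider (zero) "\<forall>\<beta>. \<alpha> \<le> \<beta>" | (succ) \<beta> where "is_pred \<beta> \<alpha>"
    | (limit) \<gamma> where "\<gamma> < \<alpha>" "\<nexists>\<beta>. is_pred \<beta> \<alpha>"
    by (metis not_le)
  then show ?case
  proof cases
    case zero
    then show ?thesis
      by (auto simp: approx_zero leD)
  next
    case succ
    have "f (approx f \<delta>) \<subseteq> f (approx f \<beta>)" if "\<delta> < \<alpha>" for \<delta>
    proof -
      have "\<delta> \<le> \<beta>" "\<beta> < \<alpha>"
        using succ that by (auto simp: is_pred_def)
      then have "approx f \<delta> \<subseteq> approx f \<beta>"
        using less[OF \<open>\<delta> < \<alpha>\<close>] less[OF \<open>\<beta> < \<alpha>\<close>] by fastforce
      then show ?thesis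
        using assms by (rule monoD[rotated])
    qed
    then show ?thesis
      using succ by (auto simp: approx_succ is_pred_def)
  next
    case limit
    have "approx f \<alpha> = (\<Union>\<beta>\<in>{..<\<alpha>}. \<Union>\<delta>\<in>{..<\<beta>}. f (approx f \<delta>))"
      using limit less by (simp add: approx_limit)
    also have "\<dots> = (\<Union>\<delta>\<in>{..<\<alpha>}. f (approx f \<delta>))"
    proof -
      \<comment> \<open>Otherwise \<delta> would be the predecessor of \<alpha>.\<close>
      have "\<exists>\<beta><\<alpha>. \<delta> < \<beta>" if "\<delta> < \<alpha>" for \<delta>
        using limit(2) that by (metis is_pred_def not_le)
      then show ?thesis
        by (fastforce dest: less_trans)
    qed
    finally show ?thesis .
  qed
qed

lemma mem_approx_iff:
  fixes \<alpha> :: "'o::wellorder"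
  assumes "mono f"
  shows "w \<in> approx f \<alpha> \<longleftrightarrow> (\<exists>\<beta><\<alpha>. w \<in> f (approx f \<beta>))"
  unfolding approx_eq_UN[OF assms, of \<alpha>] by simp blast

lemma approx_mono:
  fixes \<alpha> \<beta> :: "'o::wellorder"
  assumes "mono f" "\<alpha> \<le> \<beta>"
  shows "approx f \<alpha> \<subseteq> approx f \<beta>"
proof
  fix w
  assume "w \<in> approx f \<alpha>"
  then obtain \<delta> where "\<delta> < \<alpha>" "w \<in> f (approx f \<delta>)"
    unfolding mem_approx_iff[OF assms(1), of w \<alpha>] by blast
  then show "w \<in> approx f \<beta>"
    unfolding mem_approx_iff[OF assms(1), of w \<beta>] using assms(2) less_le_trans by blast
qed

text \<open>Countably many countable initial segments cannot cover \<open>{..<omega1}\<close>;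
  inserting each \<alpha> makes the bound strict.\<close>

lemma countable_bounded_below_omega1:
  assumes "countable A" "A \<subseteq> {..<omega1}"
  shows "\<exists>\<beta><omega1. \<forall>\<alpha>\<in>A. \<alpha> < \<beta>"
proof -
  have "countable (insert \<alpha> {..<\<alpha>})" if "\<alpha> \<in> A" for \<alpha>
    using assms(2) that countable_below_omega1 by auto
  then have "countable (\<Union>\<alpha>\<in>A. insert \<alpha> {..<\<alpha>})"
    using assms(1) by (rule countable_UN[rotated])
  then obtain \<beta> where "\<beta> < omega1" "\<beta> \<notin> (\<Union>\<alpha>\<in>A. insert \<alpha> {..<\<alpha>})"
    using uncountable_omega1 by (metis countable_subset lessThan_iff subsetI)
  then show ?thesis
    by (auto intro!: exI[of _ \<beta>] simp: not_less_iff_gr_or_eq)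
qed

text \<open>The second assumption is \<open>\<omega>\<^sub>1\<close>-continuity in the form in which a countable set of witnesses
  provides it.\<close>

lemma approx_omega1_fixpoint:
  fixes f :: "'w set \<Rightarrow> 'w set"
  assumes "mono f"
    and countable_support: "\<And>S w. w \<in> f S \<Longrightarrow> \<exists>C. countable C \<and> C \<subseteq> S \<and> w \<in> f C"
  shows "f (approx f omega1) = approx f omega1"
proof
  show "f (approx f omega1) \<subseteq> approx f omega1"
  proof
    fix w
    assume "w \<in> f (approx f omega1)"
    from countable_support[OF this] obtain C
      where C: "countable C" "C \<subseteq> approx f omega1" "w \<in> f C"
      by (elim exE conjE)
    have "\<exists>\<beta><omega1. u \<in> f (approx f \<beta>)" if "u \<in> C" for u
      using subsetD[OF C(2) that] unfolding mem_approx_iff[OF assms(1), of u omega1] .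
    then obtain b where b: "\<And>u. u \<in> C \<Longrightarrow> b u < omega1 \<and> u \<in> f (approx f (b u))"
      by metis
    \<comment> \<open>A witness \<open>u\<close> is present only after stage \<open>b u\<close>, so
      the strict bound is what puts all of \<open>C\<close> into stage \<beta>.\<close>
    then obtain \<beta> where \<beta>: "\<beta> < omega1" "\<forall>\<alpha>\<in>b ` C. \<alpha> < \<beta>"
      using countable_bounded_below_omega1[of "b ` C"] countable_image[OF C(1)] by auto
    have "C \<subseteq> approx f \<beta>"
    proof
      fix u
      assume "u \<in> C"
      then show "u \<in> approx f \<beta>"
        unfolding mem_approx_iff[OF assms(1), of u \<beta>] using b \<beta>(2) by auto
    qed
    then have "w \<in> f (approx f \<beta>)"
      using C(3) by (rule subsetD[OF monoD[OF assms(1)]])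
    then show "w \<in> approx f omega1"
      unfolding mem_approx_iff[OF assms(1), of w omega1] using \<beta>(1) by blast
  qed
  have "f (approx f \<beta>) \<subseteq> f (approx f omega1)" if "\<beta> < omega1" for \<beta>
    by (rule monoD[OF assms(1)], rule approx_mono[OF assms(1)]) (use that in simp)
  then show "approx f omega1 \<subseteq> f (approx f omega1)"
    unfolding approx_eq_UN[OF assms(1), of omega1] by (intro UN_least) simp
qed

section \<open>The operator of the translated formula\<close>

text \<open>The truth set of \<open>dia (box Bot)\<close>, the formula substituted for
  \<open>p\<close>.\<close>

definition p_worlds :: "(unit, 'w) model \<Rightarrow> 'w set" where
  "p_worlds M = {w. \<exists>u. (w, u) \<in> rel M () \<and> u \<notin> Domain (rel M ())}"

definition h_rel :: "(unit, 'w) model \<Rightarrow> 'w rel" where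
  "h_rel M = rel M () \<inter> p_worlds M \<times> p_worlds M"

definition v_rel :: "(unit, 'w) model \<Rightarrow> 'w rel" where
  "v_rel M = {(w, u). w \<in> p_worlds M \<and> u \<in> p_worlds M \<and>
     (\<exists>a b. a \<notin> p_worlds M \<and> b \<notin> p_worlds M \<and>
       (w, a) \<in> rel M () \<and> (a, b) \<in> rel M () \<and> (b, u) \<in> rel M ())}"

text \<open>One inclusion iterates a choice of successors inside the fixed point. The other is
  coinduction: a path without its first world is again such a path.\<close>

lemma gfp_eq_infinite_path:
  "gfp (\<lambda>Z. {w \<in> A. \<exists>u. (w, u) \<in> R \<and> u \<in> Z}) =
   {f 0 | f. \<forall>n::nat. f n \<in> A \<and> (f n, f (Suc n)) \<in> R}"
  (is "gfp ?F = ?P")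
proof
  have F: "mono ?F"
    by (rule monoI) blast
  have unfold: "w \<in> A \<and> (\<exists>u. (w, u) \<in> R \<and> u \<in> gfp ?F)" if "w \<in> gfp ?F" for w
    using that by (subst (asm) gfp_unfold[OF F]) simp
  show "gfp ?F \<subseteq> ?P"
  proof
    fix w
    assume w: "w \<in> gfp ?F"
    have "\<forall>y. \<exists>u. y \<in> gfp ?F \<longrightarrow> (y, u) \<in> R \<and> u \<in> gfp ?F"
      using unfold by simp
    from choice[OF this] obtain g
      where g: "\<forall>y. y \<in> gfp ?F \<longrightarrow> (y, g y) \<in> R \<and> g y \<in> gfp ?F" ..
    have "(g ^^ n) w \<in> gfp ?F" for n
      by (induction n) (simp_all add: w g)
    then have "(g ^^ n) w \<in> A \<and> ((g ^^ n) w, (g ^^ Suc n) w) \<in> R" for n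
      using unfold g by simp
    then show "w \<in> ?P"
      by (intro CollectI exI[of _ "\<lambda>n. (g ^^ n) w"]) simp
  qed
  show "?P \<subseteq> gfp ?F"
  proof (rule gfp_upperbound, rule subsetI)
    fix w
    assume "w \<in> ?P"
    then obtain f where f: "w = f (0::nat)" "\<forall>n. f n \<in> A \<and> (f n, f (Suc n)) \<in> R"
      by (elim CollectE exE conjE)
    then have "f (Suc 0) \<in> ?P"
      by (intro CollectI exI[of _ "\<lambda>n. f (Suc n)"]) simp
    then show "w \<in> ?F ?P"
      unfolding f(1) by (intro CollectI conjI exI[of _ "f (Suc 0)"]) (use f(2) in simp_all)
  qed
qed

lemma fm_op_Phi':
  assumes "distinct [x, z, p]"
  shows "fm_op (Phi' x z p) x M S =
    {f 0 | f. \<forall>n::nat. (\<exists>u\<in>S. (f n, u) \<in> v_rel M) \<and> (f n, f (Suc n)) \<in> h_rel M} \<union>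
    (p_worlds M - Domain (v_rel M))"
proof -
  \<comment> \<open>Distinct names keep \<open>x\<close> from being captured by the binder or
    replaced by the substitution, and let the substitution pass under the binder of
    \<open>z\<close>.\<close>
  have neq: "x \<noteq> z" "x \<noteq> p" "z \<noteq> p"
    using assms by auto
  \<comment> \<open>The two substituted formulas define complementary sets, so they behave as a
    literal and its negation.\<close>
  have p: "(\<exists>u. (w, u) \<in> rel M () \<and> (\<forall>v. (u, v) \<notin> rel M ())) \<longleftrightarrow> w \<in> p_worlds M"
    "(\<forall>u. (w, u) \<in> rel M () \<longrightarrow> (\<exists>v. (u, v) \<in> rel M ())) \<longleftrightarrow> w \<notin> p_worlds M" for w
    by (auto simp: p_worlds_def)
  have "fm_op (Phi' x z p) x M S =
    gfp (\<lambda>Z. {w \<in> {w. \<exists>u\<in>S. (w, u) \<in> v_rel M}. \<exists>u. (w, u) \<in> h_rel M \<and> u \<in> Z}) \<union>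
    (p_worlds M - Domain (v_rel M))"
    unfolding fm_op_def Phi'_def Phi_def
    using neq
    by (simp add: upd_def p, intro arg_cong2[where f = "(\<union>)"] arg_cong[where f = gfp] ext)
      (auto simp: v_rel_def h_rel_def)
  then show ?thesis
    unfolding gfp_eq_infinite_path by simp
qed

lemma mono_fm_op_Phi':
  assumes "distinct [x, z, p]"
  shows "mono (fm_op (Phi' x z p) x M)"
  by (rule monoI) (unfold fm_op_Phi'[OF assms], blast)

text \<open>One v-witness per position of the path suffices; worlds without v-steps need no
  witness.\<close>

lemma fm_op_Phi'_countable_support:
  assumes "distinct [x, z, p]" "w \<in> fm_op (Phi' x z p) x M S"
  shows "\<exists>C. countable C \<and> C \<subseteq> S \<and> w \<in> fm_op (Phi' x z p) x M C"
proof (cases "w \<in> p_worlds M - Domain (v_rel M)")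
  case True
  then show ?thesis
    by (intro exI[of _ "{}"]) (simp add: fm_op_Phi'[OF assms(1)])
next
  case False
  then obtain f where f: "w = f (0::nat)" "\<forall>n. (f n, f (Suc n)) \<in> h_rel M"
    and "\<forall>n. \<exists>u\<in>S. (f n, u) \<in> v_rel M"
    using assms(2) by (auto simp: fm_op_Phi'[OF assms(1)])
  then obtain u where u: "\<And>n. u n \<in> S" "\<And>n. (f n, u n) \<in> v_rel M"
    by metis
  then have "w \<in> fm_op (Phi' x z p) x M (range u)"
    using f unfolding fm_op_Phi'[OF assms(1)] by blast
  then show ?thesis
    using u(1) by (intro exI[of _ "range u"]) auto
qed

section \<open>A model of closure ordinal \<open>\<omega>\<^sub>1\<close>\<close>

text \<open>
  The worlds \<open>(\<alpha>, n, 0)\<close> form the \<open>h\<close>-path of \<open>\<alpha>\<close>. The dead end \<open>(\<alpha>, n, 1)\<close> makes \<open>p\<close> true there,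
  and \<open>(\<alpha>, n, 2)\<close>, \<open>(\<alpha>, n, 3)\<close> are the two intermediate worlds of its \<open>v\<close>-step.
\<close>

definition enum_rel :: "(ordinal \<times> nat \<times> nat) rel" where
  "enum_rel = {((\<alpha>, n, i), (\<beta>, m, j)).
    i = 0 \<and> j = 1 \<and> \<beta> = \<alpha> \<and> m = n \<or>
    i = 0 \<and> j = 0 \<and> \<beta> = \<alpha> \<and> m = Suc n \<or>
    i = 0 \<and> j = 2 \<and> \<beta> = \<alpha> \<and> m = n \<and> {..<\<alpha>} \<noteq> {} \<or>
    i = 2 \<and> j = 3 \<and> \<beta> = \<alpha> \<and> m = n \<or>
    i = 3 \<and> j = 0 \<and> \<beta> = from_nat_into {..<\<alpha>} n \<and> m = 0}"

definition enum_model :: "(unit, ordinal \<times> nat \<times> nat) model" where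
  "enum_model = \<lparr>rel = (\<lambda>_. enum_rel), val = (\<lambda>_. {})\<rparr>"

lemma enum_rel_simps:
  "((\<alpha>, n, 0), u) \<in> enum_rel \<longleftrightarrow>
    u = (\<alpha>, n, 1) \<or> u = (\<alpha>, Suc n, 0) \<or> {..<\<alpha>} \<noteq> {} \<and> u = (\<alpha>, n, 2)"
  "((\<alpha>, n, 2), u) \<in> enum_rel \<longleftrightarrow> u = (\<alpha>, n, 3)"
  "((\<alpha>, n, 3), u) \<in> enum_rel \<longleftrightarrow> u = (from_nat_into {..<\<alpha>} n, 0, 0)"
  by (cases u, auto simp: enum_rel_def)+

lemma Domain_enum_rel: "Domain enum_rel = {(\<alpha>, n, i). i \<in> {0, 2, 3}}"
proof -
  have "i \<in> {0, 2, 3}" if "((\<alpha>, n, i), u) \<in> enum_rel" for \<alpha> n i u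
    using that by (cases u) (auto simp: enum_rel_def)
  moreover have "(\<alpha>, n, i) \<in> Domain enum_rel" if "i \<in> {0, 2, 3}" for \<alpha> n i
    using that by (auto simp: Domain_iff enum_rel_simps simp del: split_paired_Ex)
  ultimately show ?thesis
    by blast
qed

text \<open>Among the worlds with a successor, only those with last component 0 see a dead end: 2
  leads to 3, and 3 leads back to 0.\<close>

lemma p_worlds_enum_model: "p_worlds enum_model = {(\<alpha>, n, i). i = 0}"
proof -
  have "(\<alpha>, n, 0) \<in> p_worlds enum_model" for \<alpha> n
    unfolding p_worlds_def
    by (intro CollectI exI[of _ "(\<alpha>, n, 1)"])
      (simp add: enum_model_def Domain_enum_rel enum_rel_simps)
  moreover have "i = 0" if p: "(\<alpha>, n, i) \<in> p_worlds enum_model" for \<alpha> n i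
  proof -
    obtain u where u: "((\<alpha>, n, i), u) \<in> enum_rel" "u \<notin> Domain enum_rel"
      using p by (auto simp: p_worlds_def enum_model_def)
    from DomainI[OF u(1)] have "i \<in> {0, 2, 3}"
      by (simp add: Domain_enum_rel)
    then show ?thesis
      using u by (auto simp: Domain_enum_rel enum_rel_simps)
  qed
  ultimately show ?thesis
    by auto
qed

lemma h_rel_enum_model:
  "(w, u) \<in> h_rel enum_model \<longleftrightarrow> (\<exists>\<alpha> n. w = (\<alpha>, n, 0) \<and> u = (\<alpha>, Suc n, 0))"
  unfolding h_rel_def p_worlds_enum_model by (auto simp: enum_model_def enum_rel_simps)

lemma v_rel_enum_model:
  "(w, u) \<in> v_rel enum_model \<longleftrightarrow>
    (\<exists>\<alpha> n. {..<\<alpha>} \<noteq> {} \<and> w = (\<alpha>, n, 0) \<and> u = (from_nat_into {..<\<alpha>} n, 0, 0))"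
  (is "?L \<longleftrightarrow> ?R")
proof
  assume ?L
  then obtain a b where "w \<in> p_worlds enum_model" "a \<notin> p_worlds enum_model"
    and edges: "(w, a) \<in> enum_rel" "(a, b) \<in> enum_rel" "(b, u) \<in> enum_rel"
    by (auto simp: v_rel_def enum_model_def)
  moreover from this obtain \<alpha> n where w: "w = (\<alpha>, n, 0)"
    by (auto simp: p_worlds_enum_model)
  ultimately have a: "a = (\<alpha>, n, 1) \<or> {..<\<alpha>} \<noteq> {} \<and> a = (\<alpha>, n, 2)"
    by (auto simp: p_worlds_enum_model enum_rel_simps)
  \<comment> \<open>The dead end also lies outside \<open>p\<close>, but no v-step can continue from
    it.\<close>
  have "(\<alpha>, n, 1) \<notin> Domain enum_rel"
    by (simp add: Domain_enum_rel)
  then have "{..<\<alpha>} \<noteq> {}" "a = (\<alpha>, n, 2)"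
    using a edges(2) by (metis DomainI)+
  then show ?R
    using w edges(2,3) by (simp add: enum_rel_simps)
next
  assume ?R
  then obtain \<alpha> n where "{..<\<alpha>} \<noteq> {}" "w = (\<alpha>, n, 0)" "u = (from_nat_into {..<\<alpha>} n, 0, 0)"
    by (elim exE conjE)
  then show ?L
    unfolding v_rel_def p_worlds_enum_model
    by (simp add: enum_model_def, intro exI[of _ \<alpha>] exI[of _ n] exI[of _ "2::nat"] exI[of _ "3::nat"])
      (simp add: enum_rel_simps)
qed

text \<open>The h-path from \<open>(\<alpha>, 0, 0)\<close> is unique, and countability of
  \<open>{..<\<alpha>}\<close> lets its v-steps reach every smaller ordinal.\<close>

lemma fm_op_Phi'_enum_model:
  assumes "distinct [x, z, p]" "\<alpha> < omega1"
  shows "(\<alpha>, 0, 0) \<in> fm_op (Phi' x z p) x enum_model S \<longleftrightarrow> (\<forall>\<beta><\<alpha>. (\<beta>, 0, 0) \<in> S)"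
proof (cases "{..<\<alpha>} = {}")
  \<comment> \<open>For the least ordinal the guard in \<open>enum_rel\<close> removes the v-steps,
    where \<open>from_nat_into\<close> would give an arbitrary value; the disjunct
    \<open>Box V Bot\<close> then holds.\<close>
  case True
  then have "(\<alpha>, 0, 0) \<in> p_worlds enum_model - Domain (v_rel enum_model)"
    by (auto simp: p_worlds_enum_model v_rel_enum_model)
  then show ?thesis
    using True by (auto simp: fm_op_Phi'[OF assms(1)])
next
  case False
  have path: "f = (\<lambda>n. (\<alpha>, n, 0))"
    if "f 0 = (\<alpha>, 0, 0)" "\<And>n. (f n, f (Suc n)) \<in> h_rel enum_model" for f
  proof
    fix n
    show "f n = (\<alpha>, n, 0)"
    proof (induction n)
      case (Suc n)
      then show ?case
        using that(2)[of n] by (auto simp: h_rel_enum_model)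
    qed (rule that(1))
  qed
  have "(\<alpha>, 0, 0) \<in> Domain (v_rel enum_model)"
    using False by (auto simp: Domain_iff v_rel_enum_model)
  then have "(\<alpha>, 0, 0) \<in> fm_op (Phi' x z p) x enum_model S \<longleftrightarrow>
    (\<exists>f. (\<alpha>, 0, 0) = f 0 \<and> (\<forall>n::nat. (\<exists>u\<in>S. (f n, u) \<in> v_rel enum_model) \<and>
      (f n, f (Suc n)) \<in> h_rel enum_model))"
    by (simp add: fm_op_Phi'[OF assms(1)])
  also have "\<dots> \<longleftrightarrow> (\<forall>n. (from_nat_into {..<\<alpha>} n, 0, 0) \<in> S)" (is "?L \<longleftrightarrow> ?R")
  proof
    assume ?L
    then obtain f where f: "f 0 = (\<alpha>, 0, 0)" "\<And>n. (f n, f (Suc n)) \<in> h_rel enum_model"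
      and v: "\<And>n. \<exists>u\<in>S. (f n, u) \<in> v_rel enum_model"
      by metis
    show ?R
      using v path[OF f] by (auto simp: v_rel_enum_model)
  next
    assume ?R
    then show ?L
      using False
      by (intro exI[of _ "\<lambda>n. (\<alpha>, n, 0)"]) (auto simp: v_rel_enum_model h_rel_enum_model)
  qed
  also have "\<dots> \<longleftrightarrow> (\<forall>\<beta>\<in>range (from_nat_into {..<\<alpha>}). (\<beta>, 0, 0) \<in> S)"
    by blast
  also have "range (from_nat_into {..<\<alpha>}) = {..<\<alpha>}"
    using False countable_below_omega1[OF assms(2)] by (rule range_from_nat_into)
  finally show ?thesis
    by auto
qed

lemma approx_enum_model:
  fixes \<gamma> :: ordinal
  assumes "distinct [x, z, p]" "\<alpha> < omega1"
  shows "(\<alpha>, 0, 0) \<in> approx (fm_op (Phi' x z p) x enum_model) \<gamma> \<longleftrightarrow> \<alpha> < \<gamma>"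
  using assms(2)
proof (induction \<gamma> arbitrary: \<alpha> rule: less_induct)
  case (less \<gamma>)
  let ?F = "fm_op (Phi' x z p) x enum_model"
  have "(\<alpha>, 0, 0) \<in> approx ?F \<gamma> \<longleftrightarrow> (\<exists>\<beta><\<gamma>. \<forall>\<delta><\<alpha>. (\<delta>, 0, 0) \<in> approx ?F \<beta>)"
    by (simp add: mem_approx_iff[OF mono_fm_op_Phi'[OF assms(1)], where \<alpha> = \<gamma>]
        fm_op_Phi'_enum_model[OF assms(1) less.prems])
  also have "\<dots> \<longleftrightarrow> (\<exists>\<beta><\<gamma>. \<forall>\<delta><\<alpha>. \<delta> < \<beta>)"
    using less.IH less.prems by (meson less_trans)
  \<comment> \<open>The inner condition amounts to \<alpha> \<le> \<beta>; the witness is \<beta> =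
    \<alpha>.\<close>
  also have "\<dots> \<longleftrightarrow> \<alpha> < \<gamma>"
    by (meson le_less_trans less_irrefl not_le)
  finally show ?case .
qed

theorem theorem7p6:
  fixes x z p :: nat
  assumes "distinct [x, z, p]"
  shows "closure_ordinal TYPE('w) TYPE(ordinal \<times> nat \<times> nat) (Phi' x z p) x omega1"
proof -
  \<comment> \<open>Its own type variable makes the fact usable both for arbitrary models and for
    \<open>enum_model\<close>.\<close>
  have fixpoint: "fm_op (Phi' x z p) x M (approx (fm_op (Phi' x z p) x M) omega1) =
      approx (fm_op (Phi' x z p) x M) omega1" for M :: "(unit, 'v) model"
    by (intro approx_omega1_fixpoint mono_fm_op_Phi' fm_op_Phi'_countable_support assms)
  have "approx (fm_op (Phi' x z p) x enum_model) \<gamma> \<noteq>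
      fm_op (Phi' x z p) x enum_model (approx (fm_op (Phi' x z p) x enum_model) \<gamma>)"
    if "\<gamma> < omega1" for \<gamma>
  proof -
    \<comment> \<open>The start world of \<gamma> separates stage \<gamma> from the next
      one.\<close>
    have "(\<gamma>, 0, 0) \<notin> approx (fm_op (Phi' x z p) x enum_model) \<gamma>"
      using approx_enum_model[OF assms that] by simp
    moreover have "(\<gamma>, 0, 0) \<in>
        fm_op (Phi' x z p) x enum_model (approx (fm_op (Phi' x z p) x enum_model) \<gamma>)"
      using that by (auto simp: fm_op_Phi'_enum_model[OF assms that]
          approx_enum_model[OF assms less_trans[OF _ that]])
    ultimately show ?thesis
      by metis
  qed
  then show ?thesis
    unfolding closure_ordinal_def using fixpoint by metis
qed

end
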